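(* For integers $n,k$ with $2\leq k\leq n-2$, $fsmp(A_{n,k})=fmp(A_{n,k})=k(n-k)$.
   Context: The $(n,k)$-arrangement graph $A_{n,k}$ ($1\leq k\leq n-1$) has as vertices all sequences $a_1a_2\ldots a_k$ of $k$ distinct elements of $\{1,\dots,n\}$; two vertices are adjacent iff they differ in exactly one position. A fractional perfect matching of $G$ is $g:E(G)\to[0,1]$ with $\sum_{e\ni v}g(e)=1$ for all $v$. $fmp(G)$ (resp. $fsmp(G)$) is the minimum size of a set $F\subseteq E(G)$ (resp. $F\subseteq V(G)\cup E(G)$) whose deletion (vertices with incident edges, and edges) leaves a graph with no fractional perfect matching. *)

theory Defs
  imports Complex_Main
begin

text \<open>A simple graph is a pair of a vertex set and a set of edges, each edge being the
  two-element set of its end vertices.\<close>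

type_synonym 'a graph = "'a set \<times> 'a set set"

abbreviation verts :: "'a graph \<Rightarrow> 'a set" where "verts \<equiv> fst"

abbreviation edges :: "'a graph \<Rightarrow> 'a set set" where "edges \<equiv> snd"

definition fractional_perfect_matching :: "'a graph \<Rightarrow> ('a set \<Rightarrow> real) \<Rightarrow> bool" where
  "fractional_perfect_matching G g \<longleftrightarrow>
     (\<forall>e\<in>edges G. 0 \<le> g e \<and> g e \<le> 1) \<and>
     (\<forall>v\<in>verts G. (\<Sum>e\<in>{e\<in>edges G. v \<in> e}. g e) = 1)"

definition has_fpm :: "'a graph \<Rightarrow> bool" where
  "has_fpm G \<longleftrightarrow> (\<exists>g. fractional_perfect_matching G g)"

definition delete_edges :: "'a graph \<Rightarrow> 'a set set \<Rightarrow> 'a graph" where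
  "delete_edges G F = (verts G, edges G - F)"

definition delete_vertices :: "'a graph \<Rightarrow> 'a set \<Rightarrow> 'a graph" where
  "delete_vertices G X = (verts G - X, {e\<in>edges G. e \<inter> X = {}})"

text \<open>A mixed fault set is a subset of the disjoint union of the vertices (tagged \<open>Inl\<close>)
  and the edges (tagged \<open>Inr\<close>), so that its cardinality counts both kinds of elements.\<close>

definition delete_mixed :: "'a graph \<Rightarrow> ('a + 'a set) set \<Rightarrow> 'a graph" where
  "delete_mixed G F = delete_edges (delete_vertices G {v. Inl v \<in> F}) {e. Inr e \<in> F}"

text \<open>The requirement \<open>finite F\<close> only matters for infinite graphs, where \<open>card\<close> would
  otherwise count an infinite fault set as having size 0. If no fault set destroys all
  fractional perfect matchings, the two numbers below are unspecified.\<close>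

definition fmp :: "'a graph \<Rightarrow> nat" where
  "fmp G = (LEAST m. \<exists>F. F \<subseteq> edges G \<and> finite F \<and> card F = m \<and>
                        \<not> has_fpm (delete_edges G F))"

definition fsmp :: "'a graph \<Rightarrow> nat" where
  "fsmp G = (LEAST m. \<exists>F. F \<subseteq> verts G <+> edges G \<and> finite F \<and> card F = m \<and>
                         \<not> has_fpm (delete_mixed G F))"

definition arrangement_verts :: "nat \<Rightarrow> nat \<Rightarrow> nat list set" where
  "arrangement_verts n k = {a. length a = k \<and> distinct a \<and> set a \<subseteq> {1..n}}"

definition arrangement_graph :: "nat \<Rightarrow> nat \<Rightarrow> nat list graph" where
  "arrangement_graph n k =
     (arrangement_verts n k,
      {{a, b} | a b. a \<in> arrangement_verts n k \<and> b \<in> arrangement_verts n k \<and>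
                     (\<exists>!i. i < k \<and> a ! i \<noteq> b ! i)})"

end

theory Submission
  imports Defs
begin

text \<open>
  Deleting the edges at one vertex gives the upper bound \<open>k(n - k)\<close>, the degree. For the lower bound,
  spreading the weight 1/2 over the edges \<open>{v, f v}\<close> of an injection \<open>f\<close> along edges gives a fractional
  perfect matching, so by Hall's theorem a graph without one has an independent set \<open>I\<close> with fewer than
  \<open>|I|\<close> neighbours. Returning to the unfaulted graph, \<open>I\<close> is cut off by a vertex set \<open>U\<close> and an edge set \<open>F\<close>,
  and it must be shown that \<open>|U| + |F| \<ge> |I| + k(n - k) - 1\<close>.

  A vertex of \<open>I\<close> on two edges of \<open>F\<close> may be moved to \<open>U\<close>, so \<open>I\<close> may be taken to induce a matching; what
  remains is a vertex expansion bound for such sets. If \<open>I\<close> is small, it follows from inclusion-exclusion,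
  because two vertices have few common neighbours; if \<open>I\<close> is large, from double counting, because each
  neighbourhood is a union of \<open>k\<close> cliques, which meet \<open>I\<close> in few vertices.
\<close>

subsection \<open>Hall's theorem and fractional perfect matchings\<close>

text \<open>Induction on \<open>card I\<close>, according to whether some proper nonempty subfamily
  is tight, that is, has exactly as many available elements as members. A tight one is matched
  within its own union and the rest outside that union; without one, a first choice may be made
  freely.\<close>

theorem hall_marriage:
  fixes S :: "'i \<Rightarrow> 'a set"
  assumes "finite I" and "\<And>i. i \<in> I \<Longrightarrow> finite (S i)"
    and "\<And>J. J \<subseteq> I \<Longrightarrow> card J \<le> card (\<Union>(S ` J))"
  shows "\<exists>f. inj_on f I \<and> (\<forall>i\<in>I. f i \<in> S i)"
  using assms
proof (induction "card I" arbitrary: I S rule: less_induct)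
  case less
  show ?case
  proof (cases "\<exists>J. J \<subset> I \<and> J \<noteq> {} \<and> card (\<Union>(S ` J)) = card J")
    case True
    then obtain J where J: "J \<subset> I" "J \<noteq> {}" "card (\<Union>(S ` J)) = card J"
      by blast
    define T where "T = \<Union>(S ` J)"
    have fin: "finite J" "finite T"
      using J less.prems finite_subset[of J I] by (auto simp: T_def)
    have "card J < card I"
      using J less.prems by (simp add: psubset_card_mono)
    moreover have "finite (S i)" if "i \<in> J" for i
      using that J less.prems(2) by blast
    moreover have "card K \<le> card (\<Union>(S ` K))" if "K \<subseteq> J" for K
      using that J by (intro less.prems(3)) blast
    ultimately have "\<exists>f. inj_on f J \<and> (\<forall>i\<in>J. f i \<in> S i)"
      using fin by (intro less.hyps)
    then obtain f where f: "inj_on f J" "\<forall>i\<in>J. f i \<in> S i"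
      by blast
    have "card (I - J) < card I"
      using J less.prems by (intro psubset_card_mono) auto
    \<comment> \<open>Hall's condition survives the removal of \<open>T\<close>: apply it to
      \<open>K \<union> J\<close> and cancel \<open>card J\<close> against
      \<open>card T\<close>.\<close>
    moreover have "card K \<le> card (\<Union>((\<lambda>i. S i - T) ` K))" if K: "K \<subseteq> I - J" for K
    proof -
      have "finite K"
        using K less.prems finite_subset by blast
      then have "card K + card J = card (K \<union> J)"
        using K fin by (subst card_Un_disjoint) auto
      also have "\<dots> \<le> card (\<Union>(S ` (K \<union> J)))"
        using K J by (intro less.prems) auto
      also have "\<Union>(S ` (K \<union> J)) = \<Union>((\<lambda>i. S i - T) ` K) \<union> T"
        by (auto simp: T_def)
      also have "card \<dots> \<le> card (\<Union>((\<lambda>i. S i - T) ` K)) + card T"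
        by (rule card_Un_le)
      finally show ?thesis
        using J by (simp add: T_def)
    qed
    ultimately have "\<exists>g. inj_on g (I - J) \<and> (\<forall>i\<in>I - J. g i \<in> S i - T)"
      using less.prems by (intro less.hyps) auto
    then obtain g where g: "inj_on g (I - J)" "\<forall>i\<in>I - J. g i \<in> S i - T"
      by blast
    have "inj_on (\<lambda>i. if i \<in> J then f i else g i) I"
      using f g unfolding inj_on_def T_def by (smt (verit) DiffD2 DiffI UN_I)
    moreover have "\<forall>i\<in>I. (if i \<in> J then f i else g i) \<in> S i"
      using f g by auto
    ultimately show ?thesis
      by blast
  next
    case no_tight: False
    show ?thesis
    proof (cases "I = {}")
      case False
      then obtain i where i: "i \<in> I"
        by blast
      then have "S i \<noteq> {}"
        using less.prems(3)[of "{i}"] by auto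
      then obtain y where y: "y \<in> S i"
        by blast
      have "card (I - {i}) < card I"
        using i less.prems by (meson card_Diff1_less)
      \<comment> \<open>Without tight subfamilies every nonempty \<open>K\<close> has an element to
        spare, which pays for the loss of \<open>y\<close>.\<close>
      moreover have "card K \<le> card (\<Union>((\<lambda>j. S j - {y}) ` K))" if K: "K \<subseteq> I - {i}" for K
      proof (cases "K = {}")
        case False
        have "K \<subset> I"
          using K i by blast
        then have "card (\<Union>(S ` K)) \<noteq> card K" "card K \<le> card (\<Union>(S ` K))"
          using no_tight False less.prems(3)[of K] by auto
        then have "card K \<le> card (\<Union>(S ` K)) - 1"
          by simp
        also have "\<dots> \<le> card (\<Union>(S ` K) - {y})"
          by (simp add: card_Diff_singleton_if)
        also have "\<Union>(S ` K) - {y} = \<Union>((\<lambda>j. S j - {y}) ` K)"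
          by blast
        finally show ?thesis .
      qed simp
      ultimately have "\<exists>g. inj_on g (I - {i}) \<and> (\<forall>j\<in>I - {i}. g j \<in> S j - {y})"
        using less.prems by (intro less.hyps) auto
      then obtain g where g: "inj_on g (I - {i})" "\<forall>j\<in>I - {i}. g j \<in> S j - {y}"
        by blast
      have "inj_on (g(i := y)) I"
        using g unfolding inj_on_def by (auto simp: fun_upd_def)
      moreover have "\<forall>j\<in>I. (g(i := y)) j \<in> S j"
        using g y by auto
      ultimately show ?thesis
        by blast
    qed simp
  qed
qed

text \<open>On a finite vertex set \<open>f\<close> is a permutation, so each \<open>v\<close>
  receives 1/2 from \<open>{v, f v}\<close> and 1/2 from \<open>{u, v}\<close> with
  \<open>f u = v\<close>.\<close>

lemma has_fpm_of_injection:
  assumes fin: "finite (verts G)"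
    and two: "\<And>e. e \<in> edges G \<Longrightarrow> \<exists>u\<in>verts G. \<exists>v\<in>verts G. u \<noteq> v \<and> e = {u, v}"
    and inj: "inj_on f (verts G)" 
    and f: "\<And>v. v \<in> verts G \<Longrightarrow> f v \<in> verts G \<and> {v, f v} \<in> edges G"
  shows "has_fpm G"
proof -
  define V where "V = verts G"
  \<comment> \<open>On an edge the count is 2 exactly when \<open>f\<close> interchanges its ends;
    both halves then fall on that edge.\<close>
  define g :: "'a set \<Rightarrow> real" where "g e = card {v\<in>V. {v, f v} = e} / 2" for e
  have finV: "finite V"
    using fin by (simp add: V_def)
  have "edges G \<subseteq> Pow V"
    using two unfolding V_def by blast
  then have finE: "finite {e\<in>edges G. v \<in> e}" for v
    using finV by (auto intro: finite_subset[of _ "Pow V"])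
  have ne: "f v \<noteq> v" if "v \<in> V" for v
    using two[of "{v, f v}"] f that by (auto simp: V_def doubleton_eq_iff)
  have "f ` V = V"
    using inj f finV by (intro endo_inj_surj) (auto simp: V_def)
  have "0 \<le> g e \<and> g e \<le> 1" if e: "e \<in> edges G" for e
  proof -
    obtain a b where "e = {a, b}"
      using two[OF e] by blast
    then have "card {v\<in>V. {v, f v} = e} \<le> card {a, b}"
      by (intro card_mono) auto
    also have "\<dots> \<le> 2"
      by (simp add: card_insert_if)
    finally show ?thesis
      by (simp add: g_def)
  qed
  moreover have "(\<Sum>e\<in>{e\<in>edges G. v \<in> e}. g e) = 1" if v: "v \<in> V" for v
  proof -
    \<comment> \<open>\<open>E\<close> carries all the weight at \<open>v\<close>. Grouping the
      vertices \<open>u\<close> by their edge \<open>{u, f u}\<close> turns the sum of weights into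
      a count of vertices.\<close>
    define E where "E = (\<lambda>u. {u, f u}) ` {u\<in>V. v \<in> {u, f u}}"
    have v_E: "v \<in> e" if "e \<in> E" for e
      using that by (auto simp: E_def)
    have E: "E \<subseteq> {e\<in>edges G. v \<in> e}"
      using f by (auto simp: E_def V_def)
    have out: "{u\<in>V. {u, f u} = e} = {}" if "e \<in> {e\<in>edges G. v \<in> e} - E" for e
      using that by (auto simp: E_def)
    obtain u where u: "u \<in> V" "f u = v"
      using v \<open>f ` V = V\<close> by (metis imageE)
    have "(\<Sum>e\<in>{e\<in>edges G. v \<in> e}. g e) = (\<Sum>e\<in>E. g e)"
      using E finE by (intro sum.mono_neutral_right) (simp_all add: g_def out)
    also have "\<dots> = (\<Sum>e\<in>E. real (card {u\<in>{u\<in>V. v \<in> {u, f u}}. {u, f u} = e})) / 2"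
      unfolding g_def sum_divide_distrib
    proof (intro sum.cong refl arg_cong[where f = "\<lambda>A. real (card A) / 2"])
      fix e assume "e \<in> E"
      from v_E[OF this] show "{v\<in>V. {v, f v} = e} = {u\<in>{u\<in>V. v \<in> {u, f u}}. {u, f u} = e}"
        by blast
    qed
    also have "(\<Sum>e\<in>E. real (card {u\<in>{u\<in>V. v \<in> {u, f u}}. {u, f u} = e}))
        = (\<Sum>e\<in>E. \<Sum>u\<in>{u\<in>{u\<in>V. v \<in> {u, f u}}. {u, f u} = e}. 1)"
      by simp
    also have "\<dots> = (\<Sum>u\<in>{u\<in>V. v \<in> {u, f u}}. 1)"
      unfolding E_def by (intro sum.image_gen[symmetric]) (simp add: finV)
    also have "{u\<in>V. v \<in> {u, f u}} = {v, u}"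
    proof -
      have "w = u" if "w \<in> V" "f w = v" for w
        using inj_onD[OF inj, of w u] that u by (simp add: V_def)
      then show ?thesis
        using u v by blast
    qed
    also have "(\<Sum>u\<in>{v, u}. 1::real) = 2"
      using ne u by auto
    finally show ?thesis
      by simp
  qed
  ultimately have "fractional_perfect_matching G g"
    unfolding fractional_perfect_matching_def V_def by simp
  then show ?thesis
    unfolding has_fpm_def by (rule exI[of _ g])
qed

text \<open>Hall's condition fails for the neighbourhoods, say at \<open>A\<close> with joint
  neighbourhood \<open>B\<close>. Removing \<open>A \<inter> B\<close> from both keeps the deficit,
  and a vertex of \<open>A - B\<close> has no neighbour in \<open>A\<close>, since otherwise it
  would lie in \<open>B\<close>.\<close>

lemma no_fpm_imp_deficient_independent_set:
  assumes fin: "finite (verts G)"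
    and two: "\<And>e. e \<in> edges G \<Longrightarrow> \<exists>u\<in>verts G. \<exists>v\<in>verts G. u \<noteq> v \<and> e = {u, v}"
    and no_fpm: "\<not> has_fpm G"
  obtains I U where "I \<subseteq> verts G" "U \<subseteq> verts G" "I \<inter> U = {}" "card U < card I"
    "\<forall>v\<in>I. \<forall>w. {v, w} \<in> edges G \<longrightarrow> w \<in> U"
proof -
  define nb where "nb v = {w\<in>verts G. {v, w} \<in> edges G}" for v
  have "\<exists>A\<subseteq>verts G. card (\<Union>(nb ` A)) < card A"
  proof (rule ccontr)
    assume *: "\<not> ?thesis"
    have "\<exists>f. inj_on f (verts G) \<and> (\<forall>v\<in>verts G. f v \<in> nb v)"
    proof (rule hall_marriage)
      show "finite (nb v)" for v
        using fin by (simp add: nb_def)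
      show "card J \<le> card (\<Union>(nb ` J))" if "J \<subseteq> verts G" for J
        using * that not_less by blast
    qed (rule fin)
    then obtain f where f: "inj_on f (verts G)" "\<forall>v\<in>verts G. f v \<in> nb v"
      by blast
    have "has_fpm G"
    proof (rule has_fpm_of_injection[OF fin two f(1)])
      show "f v \<in> verts G \<and> {v, f v} \<in> edges G" if "v \<in> verts G" for v
        using f(2) that by (simp add: nb_def)
    qed
    then show False
      using no_fpm by blast
  qed
  then obtain A where A: "A \<subseteq> verts G" "card (\<Union>(nb ` A)) < card A"
    by blast
  define B where "B = \<Union>(nb ` A)"
  have B: "B \<subseteq> verts G"
    by (auto simp: B_def nb_def)
  have finAB: "finite A" "finite B"
    using A B fin finite_subset by blast+
  have "card (B - A) + card (A \<inter> B) = card B" "card (A - B) + card (A \<inter> B) = card A"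
    using finAB by (metis Int_commute add.commute card_Int_Diff)+
  then have "card (B - A) < card (A - B)"
    using A by (simp add: B_def)
  moreover have neighbour: "w \<in> B - A" if v: "v \<in> A - B" and e: "{v, w} \<in> edges G" for v w
  proof -
    have "w \<in> verts G"
      using two[OF e] by (auto simp: doubleton_eq_iff)
    then have "w \<in> B"
      using v e by (auto simp: B_def nb_def)
    moreover have "w \<notin> A"
    proof
      assume "w \<in> A"
      then have "v \<in> B"
        using v e A by (auto simp: B_def nb_def insert_commute)
      then show False
        using v by blast
    qed
    ultimately show ?thesis
      by blast
  qed
  moreover have "A - B \<subseteq> verts G" "B - A \<subseteq> verts G" "(A - B) \<inter> (B - A) = {}"
    using A(1) B by blast+
  moreover have "\<forall>v\<in>A - B. \<forall>w. {v, w} \<in> edges G \<longrightarrow> w \<in> B - A"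
    using neighbour by blast
  ultimately show thesis
    by (intro that[of "A - B" "B - A"])
qed

subsection \<open>Expansion in regular graphs whose neighbourhoods are unions of cliques\<close>

text \<open>Here \<open>s\<close> stands for the size of the set, \<open>N\<close> for the number of
  its outer neighbours, \<open>q\<close> for the number of ordered adjacent pairs inside it and
  \<open>r\<close> for the degree. The bound \<open>small\<close> suffices up to
  \<open>s = (k - 1) * x + 1\<close>, and \<open>large\<close> beyond.\<close>

lemma expansion_arith:
  fixes k x s q N r :: int
  assumes k: "2 \<le> k" and x: "2 \<le> x" and s: "1 \<le> s" and q: "0 \<le> q" "q \<le> s" "q \<le> s * (s - 1)"
    and r: "r = k * x"
    and small: "2 * r * s \<le> 2 * N + 2 * s * (s - 1) + (x - 1) * q"
    and large: "2 * r * s \<le> 2 * k * N + (x + 1) * q"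
  shows "2 * s + 2 * r - 2 \<le> 2 * N + q"
proof (cases "s \<le> (k - 1) * x + 1")
  case True
  \<comment> \<open>By \<open>small\<close> it is enough that
    \<open>(x - 2) * q \<le> (r - s - 1) * (2 * (s - 1))\<close>, and the case assumption says
    \<open>x - 2 \<le> r - s - 1\<close>. For \<open>s = 1\<close> the bound
    \<open>q \<le> s * (s - 1)\<close> forces \<open>q = 0\<close>.\<close>
  have "q \<le> 2 * (s - 1)"
    using q s by (cases "s = 1") auto
  then have "(x - 2) * q \<le> (x - 2) * (2 * (s - 1))"
    using x by (intro mult_left_mono) auto
  also have "\<dots> \<le> (r - s - 1) * (2 * (s - 1))"
    using True s by (intro mult_right_mono) (auto simp: r algebra_simps)
  finally show ?thesis
    using small by (simp add: algebra_simps)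
next
  case False
  \<comment> \<open>In \<open>y\<close> and \<open>t\<close> the polynomial inequalities below have
    only nonnegative coefficients once both sides are subtracted.\<close>
  define y t where "y = x - 2" and "t = k - 2"
  have yt: "0 \<le> y" "0 \<le> t" and xk: "x = y + 2" "k = t + 2"
    using k x by (auto simp: y_def t_def)
  have s_ge: "(k - 1) * x + 2 \<le> s"
    using False by simp
  \<comment> \<open>The goal is multiplied by \<open>k\<close> to match \<open>large\<close>. The
    sign of \<open>x + 1 - k\<close> decides whether the term in \<open>q\<close> is bounded through
    \<open>q \<le> s\<close> or dropped.\<close>
  have "k * (2 * s + 2 * r - 2) \<le> 2 * r * s - (x + 1 - k) * q"
  proof (cases "k \<le> x + 1")
    case True
    have "0 \<le> 2 * k * x - k - x - 1"
      unfolding xk using yt by (simp add: algebra_simps)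
    then have "2 * k * (r - 1) \<le> ((k - 1) * x + 2) * (2 * k * x - k - x - 1)"
      unfolding r xk using yt by (simp add: algebra_simps)
    also have "\<dots> \<le> s * (2 * k * x - k - x - 1)"
      using s_ge \<open>0 \<le> 2 * k * x - k - x - 1\<close> by (rule mult_right_mono)
    finally have "2 * k * (r - 1) \<le> s * (2 * k * x - k - x - 1)" .
    moreover have "(x + 1 - k) * q \<le> (x + 1 - k) * s"
      using True q by (intro mult_left_mono) auto
    ultimately show ?thesis by (simp add: r algebra_simps)
  next
    case False
    have "r - 1 \<le> (x - 1) * ((k - 1) * x + 2)"
      unfolding r xk using yt by (simp add: algebra_simps)
    also have "\<dots> \<le> (x - 1) * s"
      using s_ge x by (intro mult_left_mono) auto
    finally have "k * (r - 1) \<le> k * ((x - 1) * s)"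
      using k by (intro mult_left_mono) auto
    moreover have "(x + 1 - k) * q \<le> 0"
      using False q by (intro mult_nonpos_nonneg) auto
    ultimately show ?thesis by (simp add: r algebra_simps)
  qed
  also have "\<dots> \<le> k * (2 * N + q)"
    using large by (simp add: algebra_simps)
  finally show ?thesis
    using k by simp
qed

text \<open>The colour \<open>col w v\<close> of a neighbour \<open>v\<close> of \<open>w\<close> names the clique containing \<open>v\<close>; in the
  arrangement graph it is the position in which \<open>w\<close> and \<open>v\<close> differ.\<close>

locale clique_regular =
  fixes V :: "'a set" and adj :: "'a \<Rightarrow> 'a \<Rightarrow> bool" and k x :: nat and col :: "'a \<Rightarrow> 'a \<Rightarrow> nat"
  assumes finite_V: "finite V"
    and adj_V: "adj v w \<Longrightarrow> v \<in> V"
    and adj_sym: "adj v w \<Longrightarrow> adj w v"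
    and adj_irrefl: "\<not> adj v v"
    and degree: "v \<in> V \<Longrightarrow> card {w. adj v w} = k * x"
    and col_less: "adj w v \<Longrightarrow> col w v < k"
    and col_adj: "adj w u \<Longrightarrow> adj w v \<Longrightarrow> u \<noteq> v \<Longrightarrow> col w u = col w v \<Longrightarrow> adj u v"
    and codegree_adj: "adj u v \<Longrightarrow> card {w. adj u w \<and> adj v w} \<le> x - 1"
    and codegree_nonadj: "u \<in> V \<Longrightarrow> v \<in> V \<Longrightarrow> u \<noteq> v \<Longrightarrow> \<not> adj u v \<Longrightarrow> card {w. adj u w \<and> adj v w} \<le> 2"
    and k_ge: "2 \<le> k" and x_ge: "2 \<le> x"
begin

lemma finite_adj: "finite {w. adj v w \<and> P w}"
  using adj_V adj_sym by (intro finite_subset[OF _ finite_V]) blast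

text \<open>The neighbours of \<open>w\<close> fall into \<open>k\<close> colour classes, each a
  clique. One vertex per class is free; further ones force adjacent pairs, counted here in both
  orders.\<close>

lemma neighbours_in_cliques:
  fixes w X
  defines "Y \<equiv> {v\<in>X. adj w v}"
  shows "2 * card Y \<le> 2 * k + card {(u, v) \<in> Y \<times> Y. adj u v}"
proof -
  have finY: "finite Y"
    unfolding Y_def by (rule finite_subset[OF _ finite_adj[of w "\<lambda>_. True"]]) auto
  define n where "n c = card {v\<in>Y. col w v = c}" for c
  \<comment> \<open>\<open>n \<le> 1 + n (n - 1) / 2\<close>: each colour class is a clique, so its excess over one vertex is paid by its edges\<close>
  have "3 * n c \<le> 2 + n c * n c" for c
  proof (cases "n c \<le> 2")
    case True
    then have "n c = 0 \<or> n c = 1 \<or> n c = 2" by linarith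
    then show ?thesis by (elim disjE) simp_all
  next
    case False
    then have "3 * n c \<le> n c * n c" by (intro mult_right_mono) simp_all
    then show ?thesis by (rule trans_le_add2)
  qed
  then have "(\<Sum>c<k. 3 * n c) \<le> (\<Sum>c<k. 2 + n c * n c)"
    by (intro sum_mono)
  then have "3 * (\<Sum>c<k. n c) \<le> 2 * k + (\<Sum>c<k. n c * n c)"
    by (simp only: sum_distrib_left sum.distrib) simp
  moreover have "(\<Sum>c<k. n c) = card Y"
  proof -
    have "card (\<Union>c<k. {v\<in>Y. col w v = c}) = (\<Sum>c<k. n c)"
      unfolding n_def using finY by (intro card_UN_disjoint) auto
    moreover have "(\<Union>c<k. {v\<in>Y. col w v = c}) = Y"
      using col_less by (auto simp: Y_def)
    ultimately show ?thesis by simp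
  qed
  \<comment> \<open>The squares of the colour classes are disjoint, and a pair of equal colour is
    diagonal or, by \<open>col_adj\<close>, adjacent.\<close>
  moreover have "(\<Sum>c<k. n c * n c) \<le> card Y + card {(u, v) \<in> Y \<times> Y. adj u v}"
  proof -
    let ?D = "{(u, v) \<in> Y \<times> Y. u = v}"
    have "(\<Sum>c<k. n c * n c) = (\<Sum>c<k. card ({v\<in>Y. col w v = c} \<times> {v\<in>Y. col w v = c}))"
      by (simp add: n_def card_cartesian_product)
    also have "\<dots> = card (\<Union>c<k. {v\<in>Y. col w v = c} \<times> {v\<in>Y. col w v = c})"
    proof (rule card_UN_disjoint[symmetric])
      show "\<forall>c\<in>{..<k}. finite ({v\<in>Y. col w v = c} \<times> {v\<in>Y. col w v = c})"
        using finY by simp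
      show "\<forall>c\<in>{..<k}. \<forall>c'\<in>{..<k}. c \<noteq> c' \<longrightarrow>
          ({v\<in>Y. col w v = c} \<times> {v\<in>Y. col w v = c}) \<inter> ({v\<in>Y. col w v = c'} \<times> {v\<in>Y. col w v = c'}) = {}"
        by blast
    qed simp
    also have "\<dots> \<le> card (?D \<union> {(u, v) \<in> Y \<times> Y. adj u v})"
    proof (rule card_mono)
      show "finite (?D \<union> {(u, v) \<in> Y \<times> Y. adj u v})"
        by (rule finite_subset[of _ "Y \<times> Y"]) (blast, simp add: finY)
      show "(\<Union>c<k. {v\<in>Y. col w v = c} \<times> {v\<in>Y. col w v = c}) \<subseteq> ?D \<union> {(u, v) \<in> Y \<times> Y. adj u v}"
      proof (intro UN_least subsetI)
        fix c p assume "p \<in> {v\<in>Y. col w v = c} \<times> {v\<in>Y. col w v = c}"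
        then obtain u v where p: "p = (u, v)" "u \<in> Y" "v \<in> Y" "col w u = col w v"
          by auto
        then show "p \<in> ?D \<union> {(u, v) \<in> Y \<times> Y. adj u v}"
          using col_adj[of w u v] by (cases "u = v") (simp_all add: Y_def)
      qed
    qed
    also have "\<dots> \<le> card ?D + card {(u, v) \<in> Y \<times> Y. adj u v}"
      by (rule card_Un_le)
    also have "?D = (\<lambda>v. (v, v)) ` Y"
      by auto
    also have "card \<dots> = card Y"
      by (intro card_image) (auto simp: inj_on_def)
    finally show ?thesis .
  qed
  ultimately show ?thesis
    by linarith
qed

text \<open>The edges between \<open>I\<close> and \<open>N\<close> are counted twice over: with the
  codegree bounds for pairs in \<open>I\<close>, and with the clique bound at each vertex of
  \<open>N\<close>. The two results are the hypotheses of \<open>expansion_arith\<close>. As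
  \<open>Q\<close> consists of ordered pairs, it has two elements for each inner edge.\<close>

lemma vertex_expansion:
  fixes I
  defines "N \<equiv> {w. w \<notin> I \<and> (\<exists>v\<in>I. adj v w)}"
    and "Q \<equiv> {(u, v) \<in> I \<times> I. adj u v}"
  assumes I: "I \<subseteq> V" "I \<noteq> {}" and sparse: "\<And>v. v \<in> I \<Longrightarrow> card {w\<in>I. adj v w} \<le> 1"
  shows "2 * card I + 2 * (k * x) \<le> 2 * card N + card Q + 2"
proof -
  \<comment> \<open>Integer values, because a coefficient such as \<open>int x - 3\<close> can be
    negative.\<close>
  define A :: "'a \<Rightarrow> 'a \<Rightarrow> int" where "A u v = of_bool (adj u v)" for u v
  define d where "d w = (\<Sum>v\<in>I. A v w)" for w
  define q where "q = (\<Sum>u\<in>I. \<Sum>v\<in>I. A u v)"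
  define t where "t u v = (\<Sum>w\<in>N. A u w * A v w)" for u v
  define s where "s = int (card I)"
  have finI: "finite I"
    using I finite_V finite_subset by blast
  have finN: "finite N"
    unfolding N_def using adj_V adj_sym by (intro finite_subset[OF _ finite_V]) blast
  have A_sum: "(\<Sum>v\<in>X. A u v) = int (card {v\<in>X. adj u v})" if "finite X" for u X
    using that by (simp add: A_def Int_def)
  have A_bounds: "0 \<le> A u v" "A u v \<le> 1" for u v
    by (auto simp: A_def)
  have q_card: "q = int (card Q)"
  proof -
    have "Q = (SIGMA u:I. {v\<in>I. adj u v})"
      by (auto simp: Q_def)
    then show ?thesis
      using finI by (simp add: q_def A_sum card_SigmaI)
  qed
  have degree_sum: "(\<Sum>w\<in>N. d w) + q = k * x * s"
  proof -
    have "(\<Sum>w\<in>N. A v w) + (\<Sum>w\<in>I. A v w) = k * x" if v: "v \<in> I" for v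
    proof -
      have "{w. adj v w} = {w\<in>N. adj v w} \<union> {w\<in>I. adj v w}"
        using v by (auto simp: N_def)
      also have "card \<dots> = card {w\<in>N. adj v w} + card {w\<in>I. adj v w}"
        using finI finN by (intro card_Un_disjoint finite_Collect_conjI) (auto simp: N_def)
      finally show ?thesis
        using degree[of v] v I finI finN by (simp add: A_sum subset_iff flip: of_nat_add of_nat_mult)
    qed
    then have "(\<Sum>v\<in>I. (\<Sum>w\<in>N. A v w) + (\<Sum>w\<in>I. A v w)) = k * x * s"
      by (simp add: s_def)
    then show ?thesis
      unfolding d_def q_def by (simp add: sum.distrib sum.swap[of _ N I])
  qed
  have t_card: "t u v \<le> card {w. adj u w \<and> adj v w}" for u v
  proof -
    have "t u v = (\<Sum>w\<in>N. of_bool (adj u w \<and> adj v w))"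
      unfolding t_def by (intro sum.cong) (auto simp: A_def)
    also have "\<dots> = card {w\<in>N. adj u w \<and> adj v w}"
      using finN by (simp add: Int_def)
    also have "\<dots> \<le> card {w. adj u w \<and> adj v w}"
      using finite_adj by (intro iffD2[OF of_nat_le_iff] card_mono) auto
    finally show ?thesis .
  qed
  have t_adj: "t u v \<le> int x - 1" if "adj u v" for u v
    using t_card[of u v] codegree_adj[OF that] x_ge by linarith
  \<comment> \<open>One linear expression for both codegree bounds: 2 for nonadjacent pairs,
    \<open>x - 1\<close> for adjacent ones.\<close>
  have t_le: "t u v \<le> 2 + (int x - 3) * A u v" if "u \<in> I" "v \<in> I" "u \<noteq> v" for u v
    using t_card[of u v] codegree_nonadj[of u v] t_adj[of u v] that I
    by (cases "adj u v") (simp_all add: A_def subset_iff)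
  have q_off_diag: "q = (\<Sum>u\<in>I. \<Sum>v\<in>I - {u}. A u v)"
    unfolding q_def by (intro sum.cong sum.mono_neutral_right) (auto simp: finI A_def adj_irrefl)
  have off_diag_card: "(\<Sum>u\<in>I. \<Sum>v\<in>I - {u}. c) = s * (s - 1) * c" for c :: int
  proof -
    have "(\<Sum>v\<in>I - {u}. c) = (s - 1) * c" if "u \<in> I" for u
      using card_Suc_Diff1[OF finI that] by (simp add: s_def)
    then have "(\<Sum>u\<in>I. \<Sum>v\<in>I - {u}. c) = (\<Sum>u\<in>I. (s - 1) * c)"
      by (intro sum.cong refl)
    then show ?thesis
      by (simp add: s_def)
  qed
  have small: "2 * (int k * int x) * s \<le> 2 * card N + 2 * s * (s - 1) + (int x - 1) * q"
  proof -
    \<comment> \<open>Bonferroni: \<open>d - d (d - 1) / 2 \<le> 1\<close>\<close>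
    have "2 * d w \<le> 2 + (d w * d w - d w)" for w
    proof -
      have "0 \<le> (d w - 1) * (d w - 2)"
        by (cases "d w \<le> 1") (auto intro: mult_nonpos_nonpos)
      then show ?thesis by (simp add: algebra_simps)
    qed
    then have "(\<Sum>w\<in>N. 2 * d w) \<le> (\<Sum>w\<in>N. 2 + (d w * d w - d w))"
      by (intro sum_mono)
    then have "2 * (\<Sum>w\<in>N. d w) \<le> 2 * card N + (\<Sum>w\<in>N. d w * d w - d w)"
      by (simp add: sum_distrib_left sum.distrib)
    \<comment> \<open>\<open>d w * d w - d w\<close> counts the ordered pairs of distinct neighbours
      of \<open>w\<close> in \<open>I\<close>; exchanging the sums then counts common neighbours of
      each pair.\<close>
    also have "(\<Sum>w\<in>N. d w * d w - d w) = (\<Sum>w\<in>N. \<Sum>u\<in>I. \<Sum>v\<in>I - {u}. A u w * A v w)"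
    proof (intro sum.cong refl)
      fix w
      have "(\<Sum>v\<in>I. A u w * A v w) = A u w + (\<Sum>v\<in>I - {u}. A u w * A v w)" if "u \<in> I" for u
        using finI that by (subst sum.remove[of I u]) (auto simp: A_def)
      then show "d w * d w - d w = (\<Sum>u\<in>I. \<Sum>v\<in>I - {u}. A u w * A v w)"
        unfolding d_def sum_product by (simp add: sum.distrib)
    qed
    also have "\<dots> = (\<Sum>u\<in>I. \<Sum>v\<in>I - {u}. t u v)"
      unfolding t_def by (subst sum.swap, rule sum.cong[OF refl], rule sum.swap)
    also have "\<dots> \<le> (\<Sum>u\<in>I. \<Sum>v\<in>I - {u}. 2 + (int x - 3) * A u v)"
      by (intro sum_mono t_le) auto
    also have "\<dots> = s * (s - 1) * 2 + (int x - 3) * q"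
      by (simp only: sum.distrib off_diag_card q_off_diag sum_distrib_left)
    finally show ?thesis
      using degree_sum by (simp add: algebra_simps)
  qed
  have large: "2 * (int k * int x) * s \<le> 2 * int k * card N + (int x + 1) * q"
  proof -
    \<comment> \<open>The triple product marks an adjacent pair in \<open>I\<close> whose two ends
      are adjacent to \<open>w\<close>. Summed over \<open>N\<close>, each adjacent pair is marked
      at most \<open>x - 1\<close> times.\<close>
    have "2 * d w \<le> 2 * int k + (\<Sum>u\<in>I. \<Sum>v\<in>I. A u v * (A u w * A v w))" for w
    proof -
      let ?Y = "{v\<in>I. adj w v}"
      have "d w = card ?Y"
        unfolding d_def A_sum[OF finI, symmetric] using adj_sym
        by (intro sum.cong) (auto simp: A_def)
      moreover have "(\<Sum>u\<in>I. \<Sum>v\<in>I. A u v * (A u w * A v w)) = card {(u, v) \<in> ?Y \<times> ?Y. adj u v}"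
      proof -
        have "{(u, v) \<in> ?Y \<times> ?Y. adj u v} = {p \<in> I \<times> I. case p of (u, v) \<Rightarrow> adj u v \<and> adj u w \<and> adj v w}"
          using adj_sym by auto
        moreover have "(\<Sum>u\<in>I. \<Sum>v\<in>I. A u v * (A u w * A v w))
            = (\<Sum>p\<in>I \<times> I. of_bool (case p of (u, v) \<Rightarrow> adj u v \<and> adj u w \<and> adj v w))"
          unfolding sum.cartesian_product by (intro sum.cong) (auto simp: A_def)
        ultimately show ?thesis
          using finI by (simp add: Int_def)
      qed
      ultimately show ?thesis
        using neighbours_in_cliques[of I w] by linarith
    qed
    then have "(\<Sum>w\<in>N. 2 * d w)
        \<le> (\<Sum>w\<in>N. 2 * int k + (\<Sum>u\<in>I. \<Sum>v\<in>I. A u v * (A u w * A v w)))"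
      by (intro sum_mono)
    then have "2 * (\<Sum>w\<in>N. d w)
        \<le> 2 * int k * card N + (\<Sum>w\<in>N. \<Sum>u\<in>I. \<Sum>v\<in>I. A u v * (A u w * A v w))"
      by (simp only: sum_distrib_left sum.distrib) (simp add: algebra_simps)
    also have "(\<Sum>w\<in>N. \<Sum>u\<in>I. \<Sum>v\<in>I. A u v * (A u w * A v w)) = (\<Sum>u\<in>I. \<Sum>v\<in>I. A u v * t u v)"
      unfolding t_def sum_distrib_left by (subst sum.swap, rule sum.cong[OF refl], rule sum.swap)
    also have "\<dots> \<le> (\<Sum>u\<in>I. \<Sum>v\<in>I. (int x - 1) * A u v)"
      using t_adj by (intro sum_mono) (auto simp: A_def)
    also have "\<dots> = (int x - 1) * q"
      by (simp add: q_def sum_distrib_left)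
    finally show ?thesis
      using degree_sum by (simp add: algebra_simps)
  qed
  have "q \<le> (\<Sum>u\<in>I. 1)"
    unfolding q_def A_sum[OF finI] using sparse by (intro sum_mono) auto
  moreover have "q \<le> s * (s - 1) * 1"
    unfolding q_off_diag off_diag_card[symmetric] by (intro sum_mono A_bounds)
  moreover have "1 \<le> s"
    using I finI by (simp add: s_def Suc_leI card_gt_0_iff)
  ultimately have "2 * s + 2 * (int k * int x) - 2 \<le> 2 * int (card N) + q"
    using small large k_ge x_ge
    by (intro expansion_arith[where k = "int k" and x = "int x"]) (auto simp: q_card s_def)
  then have "int (2 * card I + 2 * (k * x)) \<le> int (2 * card N + card Q + 2)"
    by (simp add: s_def q_card)
  then show ?thesis
    by (simp only: of_nat_le_iff)
qed

end

section \<open>From vertex expansion to fault sets\<close>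

lemma card_doubletons_le:
  assumes "finite F" and "\<And>w. w \<in> W \<Longrightarrow> {u, w} \<in> F"
  shows "card W \<le> card F"
proof -
  have "inj_on (\<lambda>w. {u, w}) W"
    by (auto simp: inj_on_def doubleton_eq_iff)
  then show ?thesis
    using assms by (intro card_inj_on_le[of "\<lambda>w. {u, w}"]) auto
qed

lemma card_ordered_pairs_le:
  assumes "finite Q"
  shows "card Q \<le> 2 * card ((\<lambda>(u, v). {u, v}) ` Q)"
proof -
  let ?f = "\<lambda>(u, v). {u, v}"
  have "card {p\<in>Q. ?f p = e} \<le> 2" if pair: "e \<in> ?f ` Q" for e
  proof -
    obtain a b where e: "e = {a, b}"
      using pair by auto
    have "{p\<in>Q. ?f p = e} \<subseteq> {(a, b), (b, a)}"
    proof
      fix p assume "p \<in> {p\<in>Q. ?f p = e}"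
      then have "{fst p, snd p} = {a, b}"
        by (simp add: e split_def)
      then have "fst p = a \<and> snd p = b \<or> fst p = b \<and> snd p = a"
        by (simp only: doubleton_eq_iff)
      then show "p \<in> {(a, b), (b, a)}"
        by (cases p) auto
    qed
    then have "card {p\<in>Q. ?f p = e} \<le> card {(a, b), (b, a)}"
      by (intro card_mono) simp_all
    then show ?thesis
      by (simp add: card_insert_if split: if_splits)
  qed
  then have "(\<Sum>e\<in>?f ` Q. card {p\<in>Q. ?f p = e}) \<le> (\<Sum>e\<in>?f ` Q. 2)"
    by (intro sum_mono)
  moreover have "(\<Sum>e\<in>?f ` Q. card {p\<in>Q. ?f p = e}) = card Q"
    unfolding card_eq_sum by (rule sum.image_gen[OF assms, symmetric])
  ultimately show ?thesis
    by simp
qed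

context clique_regular
begin

text \<open>Once no vertex of \<open>I\<close> lies on two members of \<open>F\<close>, each vertex
  of \<open>N - U\<close> and each edge inside \<open>I\<close> costs its own member of
  \<open>F\<close>, so \<open>vertex_expansion\<close> applies. Equality holds for a single vertex
  with exactly its incident edges in \<open>F\<close> and \<open>U\<close> empty.\<close>

lemma fault_bound:
  assumes "I \<subseteq> V" "I \<noteq> {}" "finite U" "U \<inter> I = {}" "finite F"
    and "\<And>v w. v \<in> I \<Longrightarrow> adj v w \<Longrightarrow> w \<in> U \<or> {v, w} \<in> F"
  shows "card I + k * x \<le> card U + card F + 1"
  using assms
proof (induction "card I" arbitrary: I U F rule: less_induct)
  case less
  note IV = \<open>I \<subseteq> V\<close> and finU = \<open>finite U\<close> and UI = \<open>U \<inter> I = {}\<close> and finF = \<open>finite F\<close>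
    and cover = less.prems(6)
  have finI: "finite I"
    using IV finite_V finite_subset by blast
  show ?case
    \<comment> \<open>Moving \<open>u\<close> from \<open>I\<close> to \<open>U\<close> raises \<open>|U| - |I|\<close> by two, which the edges of \<open>F\<close> at \<open>u\<close> make up for.\<close>
  proof (cases "\<exists>u\<in>I. 2 \<le> card {e\<in>F. u \<in> e}")
    case True
    then obtain u where u: "u \<in> I" "2 \<le> card {e\<in>F. u \<in> e}"
      by blast
    show ?thesis
    \<comment> \<open>The induction hypothesis needs a nonempty set, so a single vertex is settled
      directly by its degree.\<close>
    proof (cases "I = {u}")
      case True
      have "k * x = card {w. adj u w}"
        using degree u IV by (simp add: subset_iff)
      also have "\<dots> \<le> card (U \<union> {w. adj u w \<and> {u, w} \<in> F})"
        using finU finite_adj cover u by (intro card_mono) auto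
      also have "\<dots> \<le> card U + card {w. adj u w \<and> {u, w} \<in> F}"
        by (rule card_Un_le)
      also have "card {w. adj u w \<and> {u, w} \<in> F} \<le> card F"
        by (rule card_doubletons_le[OF finF, of _ u]) simp
      finally show ?thesis
        using True by simp
    next
      case False
      have "card (I - {u}) + k * x \<le> card (insert u U) + card (F - {e. u \<in> e}) + 1"
      proof (rule less.hyps)
        show "card (I - {u}) < card I"
          using finI u(1) by (rule card_Diff1_less)
        show "w \<in> insert u U \<or> {v, w} \<in> F - {e. u \<in> e}" if "v \<in> I - {u}" "adj v w" for v w
          using cover[of v w] that by auto
      qed (use IV u UI finU finF False in auto)
      moreover have "card (insert u U) = card U + 1"
        using finU UI u by (subst card_insert_disjoint) auto
      moreover have "card (F - {e. u \<in> e}) + card {e\<in>F. u \<in> e} = card F"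
        unfolding card_Int_Diff[OF finF, of "{e. u \<in> e}"] by (simp add: Int_def)
      moreover have "card (I - {u}) + 1 = card I"
        using card_Suc_Diff1[OF finI u(1)] by simp
      ultimately show ?thesis
        using u by linarith
    qed
  next
    case False
    define N where "N = {w. w \<notin> I \<and> (\<exists>v\<in>I. adj v w)}"
    define Q where "Q = {(u, v) \<in> I \<times> I. adj u v}"
    have inner: "{u, v} \<in> F" if "u \<in> I" "v \<in> I" "adj u v" for u v
      using cover[of u v] UI that by blast
    have "card {w\<in>I. adj v w} \<le> 1" if "v \<in> I" for v
    proof -
      have "card {w\<in>I. adj v w} \<le> card {e\<in>F. v \<in> e}"
        by (rule card_doubletons_le[of _ _ v]) (use finF inner that in auto)
      moreover have "\<not> 2 \<le> card {e\<in>F. v \<in> e}"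
        using False that by blast
      ultimately show ?thesis
        by linarith
    qed
    then have expansion: "2 * card I + 2 * (k * x) \<le> 2 * card N + card Q + 2"
      unfolding N_def Q_def using IV \<open>I \<noteq> {}\<close> by (intro vertex_expansion)
    have "\<exists>v. v \<in> I \<and> {v, w} \<in> F" if "w \<in> N - U" for w
      using that cover by (auto simp: N_def)
    then obtain p where p: "\<And>w. w \<in> N - U \<Longrightarrow> p w \<in> I \<and> {p w, w} \<in> F"
      by metis
    \<comment> \<open>Members of \<open>F1\<close> leave \<open>I\<close>, while those of
      \<open>F2\<close> lie inside it, so their sizes add up. The end outside \<open>I\<close>
      recovers \<open>w\<close>, which makes the choice \<open>p\<close> harmless.\<close>
    define F1 where "F1 = (\<lambda>w. {p w, w}) ` (N - U)"
    define F2 where "F2 = (\<lambda>(u, v). {u, v}) ` Q"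
    have sub: "F1 \<subseteq> F" "F2 \<subseteq> F"
      using p inner by (auto simp: F1_def F2_def Q_def)
    have "F1 \<inter> F2 = {}"
    proof -
      have "\<not> e \<subseteq> I" if "e \<in> F1" for e
        using that by (auto simp: F1_def N_def)
      moreover have "e \<subseteq> I" if "e \<in> F2" for e
        using that by (auto simp: F2_def Q_def)
      ultimately show ?thesis
        by blast
    qed
    then have "card F1 + card F2 \<le> card F"
      using sub finF by (metis card_Un_disjoint card_mono finite_subset le_sup_iff)
    moreover have "card F1 = card (N - U)"
    proof -
      have "inj_on (\<lambda>w. {p w, w}) (N - U)"
      proof (rule inj_onI)
        fix a b assume ab: "a \<in> N - U" "b \<in> N - U" "{p a, a} = {p b, b}"
        have "a \<notin> I" "p b \<in> I"
          using ab p by (simp_all add: N_def)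
        then show "a = b"
          using ab(3) by (auto simp: doubleton_eq_iff)
      qed
      then show ?thesis
        unfolding F1_def by (rule card_image)
    qed
    moreover have "card Q \<le> 2 * card F2"
      unfolding F2_def by (rule card_ordered_pairs_le, rule finite_subset[of _ "I \<times> I"])
        (auto simp: Q_def finI)
    moreover have "card N \<le> card U + card (N - U)"
    proof -
      have "finite N"
        unfolding N_def using adj_V adj_sym by (intro finite_subset[OF _ finite_V]) blast
      then have "card N \<le> card (U \<union> (N - U))"
        using finU by (intro card_mono) auto
      also have "\<dots> \<le> card U + card (N - U)"
        by (rule card_Un_le)
      finally show ?thesis .
    qed
    ultimately show ?thesis
      using expansion by linarith
  qed
qed

end

subsection \<open>Arrangement graphs\<close>

abbreviation arrangement_adj :: "nat \<Rightarrow> nat \<Rightarrow> nat list \<Rightarrow> nat list \<Rightarrow> bool" where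
  "arrangement_adj n k a b \<equiv> {a, b} \<in> edges (arrangement_graph n k)"

lemma arrangement_adj_iff:
  "arrangement_adj n k a b \<longleftrightarrow> a \<in> arrangement_verts n k \<and> b \<in> arrangement_verts n k \<and>
     (\<exists>!i. i < k \<and> a ! i \<noteq> b ! i)"
    (is "_ \<longleftrightarrow> ?R a b")
proof
  assume "arrangement_adj n k a b"
  then have "\<exists>c d. {a, b} = {c, d} \<and> ?R c d"
    by (simp only: arrangement_graph_def snd_conv mem_Collect_eq)
  then obtain c d where "{a, b} = {c, d} \<and> ?R c d"
    by (elim exE)
  then have cd: "{a, b} = {c, d}" "?R c d"
    by (rule conjunct1, rule conjunct2)
  have "?R d c"
    using cd(2) by (simp only: eq_commute[of "d ! _"] conj_ac)
  moreover have "a = c \<and> b = d \<or> a = d \<and> b = c"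
    using cd(1) by (simp only: doubleton_eq_iff)
  ultimately show "?R a b"
    using cd(2) by (elim disjE conjE) (simp_all only:)
next
  assume "?R a b"
  then show "arrangement_adj n k a b"
    unfolding arrangement_graph_def snd_conv by (intro CollectI exI[of _ a] exI[of _ b] conjI refl) blast+
qed

lemma finite_arrangement_verts: "finite (arrangement_verts n k)"
  by (rule finite_subset[OF _ finite_lists_length_eq[of "{1..n}" k]]) (auto simp: arrangement_verts_def)

lemma arrangement_adj_update_iff:
  "arrangement_adj n k a b \<longleftrightarrow>
     a \<in> arrangement_verts n k \<and> (\<exists>i<k. \<exists>y\<in>{1..n} - set a. b = a[i := y])"
proof
  assume "arrangement_adj n k a b"
  then obtain i where ab: "a \<in> arrangement_verts n k" "b \<in> arrangement_verts n k"
    and i: "i < k" "a ! i \<noteq> b ! i" and uniq: "\<And>j. j < k \<Longrightarrow> a ! j \<noteq> b ! j \<Longrightarrow> j = i"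
    unfolding arrangement_adj_iff by blast
  have len: "length a = k" "length b = k"
    using ab by (auto simp: arrangement_verts_def)
  have "b = a[i := b ! i]"
  proof (rule nth_equalityI)
    show "b ! m = a[i := b ! i] ! m" if "m < length b" for m
      using that len uniq[of m] by (metis nth_list_update_eq nth_list_update_neq)
  qed (simp add: len)
  moreover have "b ! i \<in> {1..n}"
    using ab(2) nth_mem[of i b] i len unfolding arrangement_verts_def by blast
  moreover have "b ! i \<notin> set a"
  proof
    assume "b ! i \<in> set a"
    then obtain j where j: "j < k" "a ! j = b ! i"
      using len by (auto simp: in_set_conv_nth)
    then have "j \<noteq> i" "b ! j = b ! i"
      using i uniq[of j] by metis+
    then show False
      using ab j i len by (auto simp: arrangement_verts_def nth_eq_iff_index_eq)
  qed
  ultimately show "a \<in> arrangement_verts n k \<and> (\<exists>i<k. \<exists>y\<in>{1..n} - set a. b = a[i := y])"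
    using ab i by blast
next
  assume "a \<in> arrangement_verts n k \<and> (\<exists>i<k. \<exists>y\<in>{1..n} - set a. b = a[i := y])"
  then obtain i y where a: "a \<in> arrangement_verts n k" and i: "i < k"
    and y: "y \<in> {1..n}" "y \<notin> set a" and b: "b = a[i := y]"
    by blast
  have "b \<in> arrangement_verts n k"
    using a i y set_update_subset_insert[of a i y]
    by (auto simp: b arrangement_verts_def intro!: distinct_list_update)
  moreover have "\<exists>!j. j < k \<and> a ! j \<noteq> b ! j"
  proof (rule ex1I[of _ i])
    show "i < k \<and> a ! i \<noteq> b ! i"
      using a i y by (auto simp: b arrangement_verts_def)
    show "j = i" if "j < k \<and> a ! j \<noteq> b ! j" for j
      using that by (cases "j = i") (auto simp: b)
  qed
  ultimately show "arrangement_adj n k a b"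
    using a unfolding arrangement_adj_iff by blast
qed

lemma arrangement_degree:
  assumes "a \<in> arrangement_verts n k"
  shows "card {b. arrangement_adj n k a b} = k * (n - k)"
proof -
  have len: "length a = k" and card_a: "card (set a) = k" and sub: "set a \<subseteq> {1..n}"
    using assms by (auto simp: arrangement_verts_def distinct_card)
  have "{b. arrangement_adj n k a b} = (\<lambda>(i, y). a[i := y]) ` ({..<k} \<times> ({1..n} - set a))"
    using assms unfolding arrangement_adj_update_iff by force
  moreover have "inj_on (\<lambda>(i, y). a[i := y]) ({..<k} \<times> ({1..n} - set a))"
  proof (rule inj_onI, clarify)
    fix i j y z assume *: "i < k" "j < k" "y \<notin> set a" "z \<notin> set a" "a[i := y] = a[j := z]"
    have "a[i := y] ! i = a[j := z] ! i"
      using * by simp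
    then have "i = j"
      using * len by (metis nth_list_update_eq nth_list_update_neq nth_mem)
    then show "i = j \<and> y = z"
      using * len by (metis nth_list_update_eq)
  qed
  ultimately have "card {b. arrangement_adj n k a b} = card ({..<k} \<times> ({1..n} - set a))"
    by (simp add: card_image)
  also have "\<dots> = k * (n - k)"
    using sub card_a by (simp add: card_cartesian_product card_Diff_subset)
  finally show ?thesis .
qed

lemma arrangement_codegree_adj:
  assumes "arrangement_adj n k a b"
  shows "card {c. arrangement_adj n k a c \<and> arrangement_adj n k b c} \<le> n - k - 1"
proof -
  obtain i y where a: "a \<in> arrangement_verts n k" and i: "i < k"
    and y: "y \<in> {1..n} - set a" and b: "b = a[i := y]"
    using assms unfolding arrangement_adj_update_iff by blast
  have len: "length a = k" and card_a: "card (set a) = k" and sub: "set a \<subseteq> {1..n}"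
    using a by (auto simp: arrangement_verts_def distinct_card)
  have "{c. arrangement_adj n k a c \<and> arrangement_adj n k b c}
      \<subseteq> (\<lambda>z. a[i := z]) ` ({1..n} - set a - {y})"
  proof clarify
    fix c assume c: "arrangement_adj n k a c" "arrangement_adj n k b c"
    then obtain j z where j: "j < k" and z: "z \<in> {1..n} - set a" and cj: "c = a[j := z]"
      unfolding arrangement_adj_update_iff by blast
    obtain l where l: "l < k" "b ! l \<noteq> c ! l" "\<And>m. m < k \<Longrightarrow> b ! m \<noteq> c ! m \<Longrightarrow> m = l"
      using c(2) unfolding arrangement_adj_iff by blast
    have "i = j"
    proof (rule ccontr)
      assume "i \<noteq> j"
      moreover from this have "b ! i \<noteq> c ! i" "b ! j \<noteq> c ! j"
        using i j y z len nth_mem[of i a] nth_mem[of j a] by (auto simp: b cj)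
      ultimately show False
        using l(3)[of i] l(3)[of j] i j by simp
    qed
    moreover have "z \<noteq> y"
      using l(2) \<open>i = j\<close> b cj by metis
    ultimately show "c \<in> (\<lambda>z. a[i := z]) ` ({1..n} - set a - {y})"
      using z cj by blast
  qed
  then have "card {c. arrangement_adj n k a c \<and> arrangement_adj n k b c}
      \<le> card ({1..n} - set a - {y})"
    by (rule surj_card_le[rotated]) simp
  also have "\<dots> = n - k - 1"
    using y sub card_a by (simp add: card_Diff_subset card_Diff_singleton)
  finally show ?thesis .
qed

text \<open>A common neighbour forces \<open>a\<close> and \<open>b\<close> to differ in exactly two
  positions, and it arises from \<open>a\<close> by copying the entry of \<open>b\<close> at one of
  them.\<close>

lemma arrangement_codegree_nonadj:
  assumes a: "a \<in> arrangement_verts n k" and b: "b \<in> arrangement_verts n k" and "a \<noteq> b"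
    and nadj: "\<not> arrangement_adj n k a b"
  shows "card {c. arrangement_adj n k a c \<and> arrangement_adj n k b c} \<le> 2"
proof -
  define D where "D = {i. i < k \<and> a ! i \<noteq> b ! i}"
  have len: "length a = k" "length b = k"
    using a b by (auto simp: arrangement_verts_def)
  have common: "D = {i, j} \<and> c = a[i := b ! i]"
    if i: "i < k" "\<And>m. m < k \<Longrightarrow> a ! m \<noteq> c ! m \<longleftrightarrow> m = i"
      and j: "j < k" "\<And>m. m < k \<Longrightarrow> b ! m \<noteq> c ! m \<longleftrightarrow> m = j" and c: "length c = k" for c i j
  proof -
    have sub: "m \<in> {i, j}" if "m \<in> D" for m
      using that i(2)[of m] j(2)[of m] by (auto simp: D_def)
    have "D \<noteq> {}"
      using \<open>a \<noteq> b\<close> len nth_equalityI[of a b] by (auto simp: D_def)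
    moreover have "D \<noteq> {m}" for m
    proof
      assume "D = {m}"
      then have "\<And>l. l < k \<and> a ! l \<noteq> b ! l \<longleftrightarrow> l = m"
        unfolding D_def by (simp add: set_eq_iff)
      then have "\<exists>!l. l < k \<and> a ! l \<noteq> b ! l"
        by simp
      then show False
        using nadj a b by (simp add: arrangement_adj_iff)
    qed
    ultimately have D: "D = {i, j}" "i \<noteq> j"
      using sub by blast+
    have "c = a[i := b ! i]"
    proof (rule nth_equalityI)
      fix m assume "m < length c"
      then show "c ! m = a[i := b ! i] ! m"
        using i(2)[of m] j(2)[of m] D len c by (cases "m = i") auto
    qed (simp add: len c)
    then show ?thesis
      using D by blast
  qed
  have adjE: "\<exists>i<k. \<forall>m<k. u ! m \<noteq> c ! m \<longleftrightarrow> m = i" "length c = k"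
    if adj: "arrangement_adj n k u c" for u c
  proof -
    have "\<exists>!i. i < k \<and> u ! i \<noteq> c ! i"
      using adj by (simp only: arrangement_adj_iff)
    then show "\<exists>i<k. \<forall>m<k. u ! m \<noteq> c ! m \<longleftrightarrow> m = i"
      by metis
    show "length c = k"
      using adj by (simp add: arrangement_adj_iff arrangement_verts_def)
  qed
  show ?thesis
  proof (cases "{c. arrangement_adj n k a c \<and> arrangement_adj n k b c} = {}")
    case False
    have *: "\<exists>i j. D = {i, j} \<and> c = a[i := b ! i]"
      if c: "arrangement_adj n k a c" "arrangement_adj n k b c" for c
    proof -
      obtain i j where "i < k" "\<forall>m<k. a ! m \<noteq> c ! m \<longleftrightarrow> m = i"
          and "j < k" "\<forall>m<k. b ! m \<noteq> c ! m \<longleftrightarrow> m = j"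
        using adjE(1)[OF c(1)] adjE(1)[OF c(2)] by blast
      then show ?thesis
        using common[of i c j] adjE(2)[OF c(1)] by blast
    qed
    then obtain i j where D: "D = {i, j}"
      using False by blast
    have "{c. arrangement_adj n k a c \<and> arrangement_adj n k b c} \<subseteq> (\<lambda>i. a[i := b ! i]) ` D"
      using * by blast
    then have "card {c. arrangement_adj n k a c \<and> arrangement_adj n k b c} \<le> card D"
      by (rule surj_card_le[rotated]) (simp add: D)
    also have "card D \<le> 2"
      unfolding D by (simp add: card_insert_if)
    finally show ?thesis .
  next
    case True
    show ?thesis
      unfolding True by simp
  qed
qed

lemma clique_regular_arrangement:
  assumes "2 \<le> k" and "k + 2 \<le> n"
  shows "clique_regular (arrangement_verts n k) (arrangement_adj n k) k (n - k)
    (\<lambda>a b. THE i. i < k \<and> a ! i \<noteq> b ! i)"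
proof
  have pos: "i < k \<and> a ! i \<noteq> b ! i \<longleftrightarrow> i = (THE i. i < k \<and> a ! i \<noteq> b ! i)"
    if "arrangement_adj n k a b" for a b i
    using that theI'[of "\<lambda>i. i < k \<and> a ! i \<noteq> b ! i"] unfolding arrangement_adj_iff by blast
  show "(THE i. i < k \<and> a ! i \<noteq> b ! i) < k" if "arrangement_adj n k a b" for a b
    using pos[OF that] by blast
  show "arrangement_adj n k b c"
    if "arrangement_adj n k a b" "arrangement_adj n k a c" "b \<noteq> c"
      and eq: "(THE i. i < k \<and> a ! i \<noteq> b ! i) = (THE i. i < k \<and> a ! i \<noteq> c ! i)" for a b c
  proof -
    have V: "b \<in> arrangement_verts n k" "c \<in> arrangement_verts n k"
      using that unfolding arrangement_adj_iff by blast+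
    define i where "i = (THE i. i < k \<and> a ! i \<noteq> b ! i)"
    \<comment> \<open>Both \<open>b\<close> and \<open>c\<close> agree with \<open>a\<close> outside
      position \<open>i\<close>, hence with each other.\<close>
    have only: "m = i" if "m < k" "b ! m \<noteq> c ! m" for m
      using that pos[OF \<open>arrangement_adj n k a b\<close>, of m] pos[OF \<open>arrangement_adj n k a c\<close>, of m] eq
      unfolding i_def by metis
    moreover have "\<exists>m<k. b ! m \<noteq> c ! m"
      using \<open>b \<noteq> c\<close> V nth_equalityI[of b c] by (auto simp: arrangement_verts_def)
    ultimately show ?thesis
      using V unfolding arrangement_adj_iff by blast
  qed
next
  show "finite (arrangement_verts n k)"
    by (rule finite_arrangement_verts)
  show "\<not> arrangement_adj n k a a" for a
    unfolding arrangement_adj_iff by blast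
  show "a \<in> arrangement_verts n k" "arrangement_adj n k b a"
    if "arrangement_adj n k a b" for a b
    using that by (simp only: arrangement_adj_iff) (simp only: that insert_commute)
  show "card {c. arrangement_adj n k a c \<and> arrangement_adj n k b c} \<le> n - k - 1"
    if "arrangement_adj n k a b" for a b
    using that by (rule arrangement_codegree_adj)
qed (use assms in \<open>simp_all add: arrangement_degree arrangement_codegree_nonadj\<close>)

section \<open>Fault numbers of the arrangement graph\<close>

lemma delete_edges_eq_delete_mixed: "delete_edges G F = delete_mixed G (Inr ` F)"
  by (auto simp: delete_edges_def delete_mixed_def delete_vertices_def)

text \<open>The lower bound for both numbers. A deficient set of the faulted graph is cut off in the
  full graph by \<open>U\<close> with the faulty vertices, together with the faulty edges;
  \<open>card U < card I\<close> absorbs the 1 in \<open>fault_bound\<close>.\<close>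

lemma arrangement_few_faults:
  assumes "2 \<le> k" and "k + 2 \<le> n"
    and F: "finite F" and no_fpm: "\<not> has_fpm (delete_mixed (arrangement_graph n k) F)"
  shows "k * (n - k) \<le> card F"
proof -
  let ?G = "arrangement_graph n k"
  interpret clique_regular "arrangement_verts n k" "arrangement_adj n k" k "n - k"
      "\<lambda>a b. THE i. i < k \<and> a ! i \<noteq> b ! i"
    using assms(1,2) by (rule clique_regular_arrangement)
  define Fv Fe where "Fv = Inl -` F" and "Fe = Inr -` F"
  have fin: "finite Fv" "finite Fe"
    using F by (auto simp: Fv_def Fe_def intro: finite_vimageI)
  have "F = Fv <+> Fe"
  proof (rule set_eqI)
    show "p \<in> F \<longleftrightarrow> p \<in> Fv <+> Fe" for p
      by (cases p) (auto simp: Fv_def Fe_def)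
  qed
  then have card_F: "card F = card Fv + card Fe"
    using fin by (simp add: card_Plus)
  let ?H = "delete_mixed ?G F"
  have H_verts: "verts ?H = arrangement_verts n k - Fv"
    by (simp add: delete_mixed_def delete_edges_def delete_vertices_def arrangement_graph_def Fv_def vimage_def)
  have H_edges: "edges ?H = {e\<in>edges ?G. e \<inter> Fv = {} \<and> e \<notin> Fe}"
    by (auto simp: delete_mixed_def delete_edges_def delete_vertices_def Fv_def Fe_def vimage_def)
  have ends: "\<exists>u\<in>verts ?H. \<exists>v\<in>verts ?H. u \<noteq> v \<and> e = {u, v}" if e: "e \<in> edges ?H" for e
  proof -
    obtain u v where uv: "e = {u, v}" "u \<in> arrangement_verts n k" "v \<in> arrangement_verts n k"
      using e unfolding H_edges by (auto simp: arrangement_graph_def)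
    then have "arrangement_adj n k u v" "u \<notin> Fv" "v \<notin> Fv"
      using e by (auto simp: H_edges)
    moreover from this have "u \<noteq> v"
      using adj_irrefl[of u] by metis
    ultimately show ?thesis
      using uv by (intro bexI[of _ u] bexI[of _ v]) (simp_all add: H_verts)
  qed
  have "finite (verts ?H)"
    by (simp add: H_verts finite_V)
  then obtain I U where IU: "I \<subseteq> verts ?H" "U \<subseteq> verts ?H" "I \<inter> U = {}" "card U < card I"
    and nb: "\<forall>v\<in>I. \<forall>w. {v, w} \<in> edges ?H \<longrightarrow> w \<in> U"
    using ends no_fpm by (rule no_fpm_imp_deficient_independent_set)
  have "finite U"
    using IU finite_V unfolding H_verts by (meson finite_Diff finite_subset)
  have "card I + k * (n - k) \<le> card (U \<union> Fv) + card Fe + 1"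
  proof (rule fault_bound)
    show "w \<in> U \<union> Fv \<or> {v, w} \<in> Fe" if "v \<in> I" "arrangement_adj n k v w" for v w
      using nb that IU(1) unfolding H_edges H_verts by blast
  qed (use IU fin \<open>finite U\<close> in \<open>auto simp: H_verts\<close>)
  moreover have "card (U \<union> Fv) \<le> card U + card Fv"
    by (rule card_Un_le)
  ultimately show ?thesis
    using IU card_F by linarith
qed

lemma arrangement_isolating_edges:
  assumes "k \<le> n"
  obtains F where "F \<subseteq> edges (arrangement_graph n k)" "finite F" "card F = k * (n - k)"
    "\<not> has_fpm (delete_edges (arrangement_graph n k) F)"
proof -
  let ?G = "arrangement_graph n k"
  define a where "a = [1..<Suc k]"
  have a: "a \<in> arrangement_verts n k"
    using assms by (auto simp: a_def arrangement_verts_def)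
  define F where "F = (\<lambda>b. {a, b}) ` {b. arrangement_adj n k a b}"
  have "edges ?G \<subseteq> Pow (arrangement_verts n k)"
    by (auto simp: arrangement_graph_def)
  moreover have "F \<subseteq> edges ?G"
    by (auto simp: F_def)
  ultimately have "finite F"
    using finite_arrangement_verts by (meson finite_Pow_iff finite_subset)
  have "inj (\<lambda>b. {a, b})"
    by (auto simp: inj_def doubleton_eq_iff)
  then have "card F = k * (n - k)"
    unfolding F_def using arrangement_degree[OF a] by (simp add: card_image inj_on_subset)
  have "e \<in> F" if e: "e \<in> edges ?G" "a \<in> e" for e
  proof -
    have "\<exists>c d. e = {c, d}"
      using e(1) unfolding arrangement_graph_def by auto
    then obtain b where "e = {a, b}"
      using e(2) by (metis insertE insert_commute singletonD)
    then show ?thesis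
      using e(1) by (simp add: F_def)
  qed
  \<comment> \<open>The weights at \<open>a\<close> now form an empty sum, which is 0 instead of
    1.\<close>
  then have isolated: "{e\<in>edges ?G - F. a \<in> e} = {}"
    by blast
  have "\<not> has_fpm (delete_edges ?G F)"
  proof
    assume "has_fpm (delete_edges ?G F)"
    then obtain g where "\<forall>v\<in>arrangement_verts n k. (\<Sum>e\<in>{e\<in>edges ?G - F. v \<in> e}. g e) = (1::real)"
      unfolding has_fpm_def fractional_perfect_matching_def delete_edges_def
      by (auto simp: arrangement_graph_def)
    from bspec[OF this a] show False
      unfolding isolated by simp
  qed
  show thesis
    by (rule that) fact+
qed

theorem theorem4p27:
  fixes n k :: nat
  assumes "2 \<le> k" and "k + 2 \<le> n"
  shows "fsmp (arrangement_graph n k) = k * (n - k) \<and>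
         fmp (arrangement_graph n k) = k * (n - k)"
proof -
  let ?G = "arrangement_graph n k"
  obtain F where F: "F \<subseteq> edges ?G" "finite F" "card F = k * (n - k)" "\<not> has_fpm (delete_edges ?G F)"
    by (rule arrangement_isolating_edges[of k n]) (use assms in simp)
  have "fmp ?G = k * (n - k)"
    unfolding fmp_def
  proof (rule Least_equality)
    show "\<exists>F. F \<subseteq> edges ?G \<and> finite F \<and> card F = k * (n - k) \<and> \<not> has_fpm (delete_edges ?G F)"
      using F by blast
    fix m assume "\<exists>F. F \<subseteq> edges ?G \<and> finite F \<and> card F = m \<and> \<not> has_fpm (delete_edges ?G F)"
    \<comment> \<open>Tagging with \<open>Inr\<close> turns an edge fault set into a mixed one of
      the same size.\<close>
    then show "k * (n - k) \<le> m"
      using arrangement_few_faults[OF assms, of "Inr ` _"]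
      by (auto simp: delete_edges_eq_delete_mixed card_image)
  qed
  moreover have "fsmp ?G = k * (n - k)"
    unfolding fsmp_def
  proof (rule Least_equality)
    show "\<exists>F. F \<subseteq> verts ?G <+> edges ?G \<and> finite F \<and> card F = k * (n - k) \<and>
        \<not> has_fpm (delete_mixed ?G F)"
      using F by (intro exI[of _ "Inr ` F"]) (auto simp: delete_edges_eq_delete_mixed card_image)
    fix m assume "\<exists>F. F \<subseteq> verts ?G <+> edges ?G \<and> finite F \<and> card F = m \<and> \<not> has_fpm (delete_mixed ?G F)"
    then show "k * (n - k) \<le> m"
      using arrangement_few_faults[OF assms] by blast
  qed
  ultimately show ?thesis
    by blast
qed

end
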